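(* The operad of cooperative games $\mathbb G$ is generated under composition by the $2$-player bargaining game $B$ and the $2$-player dictator games $d_1$ and $d_2$. Thus, for every $n\ge 1$, any $n$-player game is a linear combination of iterated partial compositions of $n-1$ games, each of which is $B$, $d_1$ or $d_2$ (for $n=1$ the empty composite being the operadic unit).
   Context: An $n$-player game is a function $v:\mathcal P([n])\to\mathbb R$ with $v(\emptyset)=0$; these form the vector space $\mathbb G(n)$, with $\mathbb S_n$-action $(\sigma\star v)(S)=v(\sigma^{-1}(S))$. For $\alpha$ on the ordered player set $A$, $\beta$ on the ordered player set $B'$ (disjoint), $i\in A$, the game $\alpha\circ_i\beta$ has player set $(A\setminus\{i\})\cup B'$ ($B'$ inserted in order in the place of $i$; ordered sets of $n$ players are identified with $[n]$) and $$(\alpha\circ_i\beta)(S)=\beta(B')\alpha(S\cap A)+\partial_i\alpha(S\cap A)\,\beta(S\cap B'),\qquad \partial_i\alpha(T)=\alpha(T\cup\{i\})-\alpha(T\setminus\{i\}).$$ With these compositions and the $1$-player game of value $1$ as unit, $\mathbb G$ is an operad in real vector spaces. The $2$-player games are: $B(\{1,2\})=1$ and $B(S)=0$ otherwise; $d_j(S)=1$ if $j\in S$ and $0$ otherwise ($j=1,2$). *)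

theory Defs
  imports Complex_Main "HOL-Library.Function_Algebras" "HOL-Combinatorics.Permutations"
begin

text \<open>
  A game on the players \<open>{1..n}\<close> is a set function, extended by \<open>0\<close> to the sets that are not
  coalitions, so that equality of games is equality of functions. The zero extension of a game
  is also a game on any larger player set; hence arities are always passed explicitly.
\<close>

type_synonym game = "nat set \<Rightarrow> real"

definition games :: "nat \<Rightarrow> game set" where
  "games n = {v. v {} = 0 \<and> (\<forall>S. \<not> S \<subseteq> {1..n} \<longrightarrow> v S = 0)}"

definition game_scale :: "real \<Rightarrow> game \<Rightarrow> game" where
  "game_scale c v = (\<lambda>S. c * v S)"

global_interpretation game: vector_space game_scale
  defines game_span = game.span and game_subspace = game.subspace
  by unfold_locales (auto simp: game_scale_def fun_eq_iff algebra_simps)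

definition game_act :: "(nat \<Rightarrow> nat) \<Rightarrow> game \<Rightarrow> game" where
  "game_act \<sigma> v = (\<lambda>S. v (inv \<sigma> ` S))"

definition game_deriv :: "nat \<Rightarrow> game \<Rightarrow> game" where
  "game_deriv i v = (\<lambda>T. v (T \<union> {i}) - v (T - {i}))"

text \<open>
  In \<open>a \<circ>\<^sub>i b\<close>, with \<open>a\<close> on \<open>n\<close> and \<open>b\<close> on \<open>m\<close> players, the \<open>n + m - 1\<close> players are numbered as
  follows: player \<open>j\<close> of \<open>a\<close> keeps its number if \<open>j < i\<close> and becomes \<open>j + m - 1\<close> if \<open>j > i\<close>, and
  player \<open>j\<close> of \<open>b\<close> becomes \<open>i + j - 1\<close>. The next two functions give the part of a coalition \<open>S\<close>
  consisting of players of \<open>a\<close>, respectively of \<open>b\<close>, in the original numbering.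
\<close>

definition outer_part :: "nat \<Rightarrow> nat \<Rightarrow> nat \<Rightarrow> nat set \<Rightarrow> nat set" where
  "outer_part n i m S =
     {j \<in> {1..n}. (j < i \<and> j \<in> S) \<or> (i < j \<and> j + m - 1 \<in> S)}"

definition inner_part :: "nat \<Rightarrow> nat \<Rightarrow> nat set \<Rightarrow> nat set" where
  "inner_part i m S = {j \<in> {1..m}. i + j - 1 \<in> S}"

definition game_comp :: "nat \<Rightarrow> nat \<Rightarrow> nat \<Rightarrow> game \<Rightarrow> game \<Rightarrow> game" where
  "game_comp n i m a b = (\<lambda>S.
     if S \<subseteq> {1..n + m - 1}
     then b {1..m} * a (outer_part n i m S)
          + game_deriv i a (outer_part n i m S) * b (inner_part i m S)
     else 0)"

definition game_unit :: game where
  "game_unit = (\<lambda>S. if S = {1} then 1 else 0)"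

definition bargaining :: game where
  "bargaining = (\<lambda>S. if S = {1, 2} then 1 else 0)"

definition dictator :: "nat \<Rightarrow> game" where
  "dictator j = (\<lambda>S. if S \<subseteq> {1, 2} \<and> j \<in> S then 1 else 0)"

definition suboperad :: "(nat \<Rightarrow> game set) \<Rightarrow> bool" where
  "suboperad P \<longleftrightarrow>
     (\<forall>n. P n \<subseteq> games n \<and> game_subspace (P n)) \<and>
     game_unit \<in> P 1 \<and>
     (\<forall>n. \<forall>\<sigma> v. \<sigma> permutes {1..n} \<longrightarrow> v \<in> P n \<longrightarrow> game_act \<sigma> v \<in> P n) \<and>
     (\<forall>n m. \<forall>i\<in>{1..n}. \<forall>a\<in>P n. \<forall>b\<in>P m. game_comp n i m a b \<in> P (n + m - 1))"

definition generated_suboperad :: "(nat \<Rightarrow> game set) \<Rightarrow> nat \<Rightarrow> game set" where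
  "generated_suboperad X n = \<Inter> {P n | P. suboperad P \<and> (\<forall>k. X k \<subseteq> P k)}"

text \<open>
  \<open>iterated_comp X k n w\<close>: the \<open>n\<close>-player game \<open>w\<close> is an iterated partial composition of \<open>k\<close>
  games from \<open>X\<close> (counted with repetition). No linear combinations and no permutations of the
  players are involved; occurrences of the unit are not counted.
\<close>

inductive iterated_comp :: "(nat \<Rightarrow> game set) \<Rightarrow> nat \<Rightarrow> nat \<Rightarrow> game \<Rightarrow> bool"
  for X :: "nat \<Rightarrow> game set" where
  unit: "iterated_comp X 0 1 game_unit"
| generator: "x \<in> X n \<Longrightarrow> iterated_comp X 1 n x"
| comp: "iterated_comp X k n a \<Longrightarrow> iterated_comp X l m b \<Longrightarrow> i \<in> {1..n} \<Longrightarrow>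
    iterated_comp X (k + l) (n + m - 1) (game_comp n i m a b)"

definition two_player_generators :: "nat \<Rightarrow> game set" where
  "two_player_generators n =
     (if n = 2 then {bargaining, dictator 1, dictator 2} else {})"

lemma game_act_games:
  assumes "\<sigma> permutes {1..n}" "v \<in> games n"
  shows "game_act \<sigma> v \<in> games n"
proof -
  have "\<not> inv \<sigma> ` S \<subseteq> {1..n}" if "\<not> S \<subseteq> {1..n}" for S
    using that permutes_in_image[OF permutes_inv[OF assms(1)]] by blast
  then show ?thesis
    using assms(2) by (auto simp: games_def game_act_def)
qed

lemma game_comp_games:
  assumes "a \<in> games n" "b \<in> games m"
  shows "game_comp n i m a b \<in> games (n + m - 1)"
  using assms by (auto simp: games_def game_comp_def outer_part_def inner_part_def)

lemma suboperad_games: "suboperad games"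
proof -
  have "game_subspace (games n)" for n
    by (rule game.subspaceI) (auto simp: games_def game_scale_def)
  moreover have "game_unit \<in> games 1"
    by (auto simp: games_def game_unit_def)
  ultimately show ?thesis
    by (auto simp: suboperad_def simp del: One_nat_def intro: game_act_games game_comp_games)
qed

lemma two_player_generators_games: "two_player_generators n \<subseteq> games n"
proof -
  have "{1..2} = {1, 2::nat}" by auto
  then show ?thesis
    by (auto simp: two_player_generators_def games_def bargaining_def dictator_def)
qed

end

theory Submission
  imports Defs
begin

text \<open>
  A game \<open>v\<close> on \<open>n + 1\<close> players splits according to whether the last player takes part. With
  \<open>T = S \<inter> {1..n}\<close> one has
  \<open>v S = v T + [n + 1 \<in> S] * (w T + c)\<close>, where \<open>c = v {n + 1}\<close> is the value of the last player
  alone, and \<open>w T = v (T \<union> {n + 1}) - v T - c\<close> vanishes at the empty coalition and so is again a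
  game on \<open>n\<close> players. Each summand is a generator with a game on \<open>n\<close> players
  grafted into its first input: \<open>d\<^sub>1\<close> makes the last player a dummy, which gives \<open>v T\<close>; \<open>B\<close>
  makes the last player a veto player, which gives \<open>[n + 1 \<in> S] * w T\<close>; and \<open>d\<^sub>2\<close> makes the last
  player a dictator, scaled by the value of the grand coalition \<open>{1..n}\<close>
  (lemma \<open>game_split_last_player\<close>).

  Composition is linear in its inner argument, so by induction on \<open>n\<close> every game is a linear
  combination of left combs in \<open>B\<close>, \<open>d\<^sub>1\<close>, \<open>d\<^sub>2\<close>; the comb of arity one is the unit, which spans
  the games on one player. A suboperad that contains the generators contains their iterated compositions
  and linear combinations of these, hence every game.
\<close>

lemma outer_part_2_1: "outer_part 2 1 n S = (if Suc n \<in> S then {2} else {})"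
proof -
  have "{1..2} = {1, 2::nat}"
    by auto
  then show ?thesis
    by (auto simp: outer_part_def)
qed

lemma inner_part_1: "inner_part 1 n S = S \<inter> {1..n}"
  by (auto simp: inner_part_def)

lemma dictator_1_comp:
  "game_comp 2 1 n (dictator 1) a =
     (\<lambda>S. if S \<subseteq> {1..Suc n} then a (S \<inter> {1..n}) else 0)"
  by (rule ext)
     (simp add: game_comp_def outer_part_2_1[simplified] inner_part_1[simplified]
        game_deriv_def dictator_def)

lemma dictator_2_comp:
  "game_comp 2 1 n (dictator 2) a =
     (\<lambda>S. if S \<subseteq> {1..Suc n} \<and> Suc n \<in> S then a {1..n} else 0)"
  by (rule ext)
     (simp add: game_comp_def outer_part_2_1[simplified] inner_part_1[simplified]
        game_deriv_def dictator_def)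

lemma bargaining_comp:
  "game_comp 2 1 n bargaining a =
     (\<lambda>S. if S \<subseteq> {1..Suc n} \<and> Suc n \<in> S then a (S \<inter> {1..n}) else 0)"
proof -
  have "{2} \<noteq> {1, 2::nat}" "{2, 1} = {1, 2::nat}" "{1} \<noteq> {1, 2::nat}" "{2::nat} - {1} = {2}"
    by auto
  then show ?thesis
    by (intro ext)
       (simp add: game_comp_def outer_part_2_1[simplified] inner_part_1[simplified]
          game_deriv_def bargaining_def insert_commute)
qed

text \<open>
  The last summand needs some game whose grand coalition has value \<open>v {Suc n}\<close>; a multiple of the
  unanimity game of \<open>{1..n}\<close> serves. The hypothesis \<open>n \<ge> 1\<close> is what makes it a game: the grand
  coalition must be nonempty.
\<close>

lemma game_split_last_player:
  assumes v: "v \<in> games (Suc n)" and n: "n \<ge> 1"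
  obtains a b c where "a \<in> games n" "b \<in> games n" "c \<in> games n"
    "v = game_comp 2 1 n (dictator 1) a + game_comp 2 1 n bargaining b
           + game_comp 2 1 n (dictator 2) c"
proof -
  define a :: game where "a = (\<lambda>T. if T \<subseteq> {1..n} then v T else 0)"
  \<comment> \<open>Subtracting the value of the last player alone makes \<open>b\<close> vanish at the empty coalition.\<close>
  define b :: game where
    "b = (\<lambda>T. if T \<subseteq> {1..n} then v (insert (Suc n) T) - v T - v {Suc n} else 0)"
  define c :: game where "c = (\<lambda>T. if T = {1..n} then v {Suc n} else 0)"
  have v_out: "v S = 0" if "\<not> S \<subseteq> {1..Suc n}" for S
    using v that by (auto simp: games_def)
  have v_empty: "v {} = 0"
    using v by (simp add: games_def)
  have "a \<in> games n" "b \<in> games n" "c \<in> games n"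
    using n v_empty by (auto simp: games_def a_def b_def c_def)
  moreover have "v S = (game_comp 2 1 n (dictator 1) a + game_comp 2 1 n bargaining b
           + game_comp 2 1 n (dictator 2) c) S" for S
  proof (cases "S \<subseteq> {1..Suc n}")
    case True
    show ?thesis
    proof (cases "Suc n \<in> S")
      case last: True
      with True have "insert (Suc n) (S \<inter> {1..n}) = S"
        by (auto simp: le_Suc_eq)
      with True last show ?thesis
        by (simp only: plus_fun_apply dictator_1_comp dictator_2_comp bargaining_comp)
           (simp add: a_def b_def c_def)
    next
      case False
      with True have "S \<inter> {1..n} = S"
        by (auto simp: le_Suc_eq)
      with True False show ?thesis
        by (simp only: plus_fun_apply dictator_1_comp dictator_2_comp bargaining_comp)
           (auto simp add: a_def)
    qed
  next
    case False
    then show ?thesis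
      by (simp only: plus_fun_apply dictator_1_comp dictator_2_comp bargaining_comp)
         (simp add: v_out)
  qed
  ultimately show ?thesis
    using that by blast
qed

lemma game_comp_add_right:
  "game_comp n i m x (a + b) = game_comp n i m x a + game_comp n i m x b"
  by (auto simp: game_comp_def fun_eq_iff algebra_simps)

lemma game_comp_scale_right:
  "game_comp n i m x (game_scale c a) = game_scale c (game_comp n i m x a)"
  by (auto simp: game_comp_def game_scale_def fun_eq_iff algebra_simps)

lemma game_comp_zero_right: "game_comp n i m x 0 = 0"
  by (auto simp: game_comp_def fun_eq_iff)

text \<open>
  Because composition is linear in the inner argument, only the iterated compositions spanning
  the inner games have to be grafted, and each grafting uses up exactly one more generator.
\<close>

lemma generator_comp_in_span:
  assumes x: "x \<in> X n" and i: "i \<in> {1..n}"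
    and a: "a \<in> game_span {w. iterated_comp X k m w}"
  shows "game_comp n i m x a \<in> game_span {w. iterated_comp X (Suc k) (n + m - 1) w}"
    (is "_ \<in> ?W")
  using a
proof (induction rule: game.span_induct_alt)
  case base
  show ?case
    unfolding game_comp_zero_right by (rule game.span_zero)
next
  case (step c y z)
  then have "iterated_comp X (Suc k) (n + m - 1) (game_comp n i m x y)"
    using iterated_comp.comp[OF iterated_comp.generator[of x X n, OF x] _ i] by auto
  then show ?case
    unfolding game_comp_add_right game_comp_scale_right
    using step.IH by (intro game.span_add game.span_scale) (auto intro: game.span_base)
qed

text \<open>
  Stated at \<open>Suc n\<close> because \<open>n\<close> generators of arity two compose to arity \<open>n + 1\<close>.
\<close>

lemma games_subset_span_iterated_comp:
  "games (Suc n) \<subseteq> game_span {w. iterated_comp two_player_generators n (Suc n) w}"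
proof (induction n)
  case 0
  have "v = game_scale (v {1}) game_unit" if v: "v \<in> games 1" for v
  proof
    fix S :: "nat set"
    consider "S = {}" | "S = {1}" | "\<not> S \<subseteq> {1..1}"
      by auto
    then show "v S = game_scale (v {1}) game_unit S"
      by cases (use v in \<open>auto simp: games_def game_scale_def game_unit_def\<close>)
  qed
  moreover have "game_unit \<in> {w. iterated_comp two_player_generators 0 1 w}"
    using iterated_comp.unit by blast
  ultimately show ?case
    using game.span_scale[OF game.span_base] by (simp only: One_nat_def subset_iff) metis
next
  case (Suc n)
  let ?W = "game_span {w. iterated_comp two_player_generators (Suc n) (Suc (Suc n)) w}"
  have graft: "game_comp 2 1 (Suc n) x a \<in> ?W"
    if "x \<in> {bargaining, dictator 1, dictator 2}" "a \<in> games (Suc n)" for x a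
  proof -
    have "x \<in> two_player_generators 2"
      using that by (simp add: two_player_generators_def)
    moreover have "a \<in> game_span {w. iterated_comp two_player_generators n (Suc n) w}"
      using that Suc by blast
    ultimately show ?thesis
      using generator_comp_in_span[of x two_player_generators 2 1 a n "Suc n"] by simp
  qed
  show ?case
  proof
    fix v assume "v \<in> games (Suc (Suc n))"
    then obtain a b c where "a \<in> games (Suc n)" "b \<in> games (Suc n)" "c \<in> games (Suc n)"
      and v: "v = game_comp 2 1 (Suc n) (dictator 1) a + game_comp 2 1 (Suc n) bargaining b
           + game_comp 2 1 (Suc n) (dictator 2) c"
      by (rule game_split_last_player) auto
    then show "v \<in> ?W"
      unfolding v by (intro game.span_add graft) auto
  qed
qed

lemma iterated_comp_in_suboperad:
  assumes "iterated_comp X k n w" and "suboperad P" and "\<And>j. X j \<subseteq> P j"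
  shows "w \<in> P n"
  using assms(1)
proof induction
  case unit
  show ?case
    using assms(2) unfolding suboperad_def by blast
next
  case (generator x n)
  then show ?case
    using assms(3) by blast
next
  case (comp k n a l m b i)
  then show ?case
    using assms(2) unfolding suboperad_def by blast
qed

theorem corollary1:
  "generated_suboperad two_player_generators = games \<and>
   (\<forall>n\<ge>1. \<forall>v\<in>games n.
      v \<in> game_span {w. iterated_comp two_player_generators (n - 1) n w})"
proof
  show span: "\<forall>n\<ge>1. \<forall>v\<in>games n.
      v \<in> game_span {w. iterated_comp two_player_generators (n - 1) n w}"
  proof (intro allI impI ballI)
    fix n :: nat and v assume "1 \<le> n" "v \<in> games n"
    then show "v \<in> game_span {w. iterated_comp two_player_generators (n - 1) n w}"
      using games_subset_span_iterated_comp[of "n - 1"] by auto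
  qed
  show "generated_suboperad two_player_generators = games"
  proof (intro ext equalityI)
    fix n
    show "generated_suboperad two_player_generators n \<subseteq> games n"
      unfolding generated_suboperad_def
      using suboperad_games two_player_generators_games by blast
    have "games n \<subseteq> P n"
      if P: "suboperad P" and gen: "\<And>k. two_player_generators k \<subseteq> P k" for P
    proof (cases "n = 0")
      \<comment> \<open>There is no composition of arity \<open>0\<close>, but the only game without players is zero.\<close>
      case True
      have "v = 0" if v: "v \<in> games 0" for v
      proof
        fix S :: "nat set"
        show "v S = 0 S"
          by (cases "S = {}") (use v in \<open>auto simp: games_def\<close>)
      qed
      moreover have "0 \<in> P n"
        using P game.subspace_0 unfolding suboperad_def by blast
      ultimately show ?thesis
        using True by auto
    next
      case False
      have "game_subspace (P n)"
        using P unfolding suboperad_def by blast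
      then have "game_span {w. iterated_comp two_player_generators (n - 1) n w} \<subseteq> P n"
        using iterated_comp_in_suboperad[OF _ P gen] by (intro game.span_minimal) auto
      then show ?thesis
        using span False by (metis One_nat_def Suc_leI neq0_conv subset_iff)
    qed
    then show "games n \<subseteq> generated_suboperad two_player_generators n"
      unfolding generated_suboperad_def by blast
  qed
qed

end
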